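(* Let $h:\mathbb{R}^n\to\overline{\mathbb{R}}$ be a proper function, $\overline{x}\in\arg\min_{\mathbb{R}^n}h$, $\kappa_1\in(0,1)$, and $\gamma\ge 0$. Assume that $h$ is $(\kappa_1,\gamma)$-strongly quasar-convex with respect to $\overline{x}$. Let $I\subseteq\mathbb{R}$ be an interval such that $h(\mathbb{R}^n)\subseteq I$, and let $\varphi:I\to\mathbb{R}$ be a $\kappa_2$-quasar-convex function with respect to $h(\overline{x})$, where $\kappa_2\in(0,1]$. Suppose in addition that there exists $m\ge 0$ such that $$\varphi(t)-\varphi(s)\ge m(t-s),\qquad\forall\, t\ge s,\ t,s\in I.$$ Then the function $g:\mathbb{R}^n\to\mathbb{R}$ given by $g:=\varphi\circ h$ is $(\kappa,\gamma_g)$-strongly quasar-convex with respect to $\overline{x}$, where $\kappa:=\kappa_1\kappa_2$, $\gamma_g:=\frac{C_{\kappa_1,\kappa_2}\,m\,\gamma}{\kappa_2}$, and $$C_{\kappa_1,\kappa_2}:=\inf_{\lambda\in[0,1]}\frac{1-\frac{\lambda}{2-\kappa_1}}{1-\frac{\lambda}{2-\kappa_1\kappa_2}}=\frac{(1-\kappa_1)(2-\kappa_1\kappa_2)}{(2-\kappa_1)(1-\kappa_1\kappa_2)}>0.$$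
   Context: $\overline{\mathbb{R}}=\mathbb{R}\cup\{+\infty\}$; $\mathrm{dom}(h)=\{x:h(x)<+\infty\}$; $h$ is proper if $\mathrm{dom}(h)\neq\emptyset$; $\|\cdot\|$ is the Euclidean norm. Let $\kappa\in(0,1]$, $\gamma\ge 0$. A proper function $h:\mathbb{R}^n\to\overline{\mathbb{R}}$ with convex domain and $\arg\min_{\mathbb{R}^n}h\neq\emptyset$ is called $(\kappa,\gamma)$-strongly quasar-convex with respect to $\overline{x}\in\arg\min_{\mathbb{R}^n}h$ if for all $x\in\mathrm{dom}(h)$ and all $\lambda\in[0,1]$, $$h(\lambda\overline{x}+(1-\lambda)x)\le\kappa\lambda h(\overline{x})+(1-\kappa\lambda)h(x)-\lambda\left(1-\frac{\lambda}{2-\kappa}\right)\frac{\kappa\gamma}{2}\|x-\overline{x}\|^2.$$ If $\gamma=0$, $h$ is called $\kappa$-quasar-convex with respect to $\overline{x}$. For $\varphi:I\to\mathbb{R}$ on an interval $I$ the same definition is used with domain $I$ (so $h(\overline{x})$ is a minimizer of $\varphi$ over $I$). *)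

theory Defs
  imports "HOL-Analysis.Analysis"
begin

text \<open>
  Functions with values in \<open>\<real> \<union> {+\<infinity>}\<close> are functions into \<^typ>\<open>ereal\<close> that never take
  the value \<open>-\<infinity>\<close>; this condition is part of \<open>proper\<close>.
\<close>

definition effective_domain :: "('a \<Rightarrow> ereal) \<Rightarrow> 'a set" where
  "effective_domain h = {x. h x < \<infinity>}"

definition proper :: "('a \<Rightarrow> ereal) \<Rightarrow> bool" where
  "proper h \<longleftrightarrow> (\<forall>x. h x \<noteq> -\<infinity>) \<and> effective_domain h \<noteq> {}"

text \<open>
  For \<open>x\<close> in the effective domain, \<open>h xbar \<le> h x < \<infinity>\<close>, so all terms on the right-hand
  side of the inequality below are finite and its \<^typ>\<open>ereal\<close> arithmetic is that of the reals.
\<close>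

definition strongly_quasar_convex ::
    "real \<Rightarrow> real \<Rightarrow> ('a::euclidean_space \<Rightarrow> ereal) \<Rightarrow> 'a \<Rightarrow> bool" where
  "strongly_quasar_convex \<kappa> \<gamma> h xbar \<longleftrightarrow>
     0 < \<kappa> \<and> \<kappa> \<le> 1 \<and> 0 \<le> \<gamma> \<and>
     proper h \<and> convex (effective_domain h) \<and> is_arg_min h (\<lambda>_. True) xbar \<and>
     (\<forall>x \<in> effective_domain h. \<forall>l \<in> {0..1}.
        h (l *\<^sub>R xbar + (1 - l) *\<^sub>R x)
          \<le> ereal (\<kappa> * l) * h xbar + ereal (1 - \<kappa> * l) * h x
             - ereal (l * (1 - l / (2 - \<kappa>)) * (\<kappa> * \<gamma> / 2) * (norm (x - xbar))\<^sup>2))"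

definition quasar_convex :: "real \<Rightarrow> ('a::euclidean_space \<Rightarrow> ereal) \<Rightarrow> 'a \<Rightarrow> bool" where
  "quasar_convex \<kappa> h xbar \<longleftrightarrow> strongly_quasar_convex \<kappa> 0 h xbar"

text \<open>
  A function \<open>\<phi> : I \<rightarrow> \<real>\<close> is identified with its extension by \<open>+\<infinity>\<close>, whose effective
  domain is \<open>I\<close> and whose minimizers are (for nonempty \<open>I\<close>) those of \<open>\<phi>\<close> over \<open>I\<close>.
\<close>

definition extend_infty :: "'a set \<Rightarrow> ('a \<Rightarrow> real) \<Rightarrow> 'a \<Rightarrow> ereal" where
  "extend_infty I \<phi> = (\<lambda>t. if t \<in> I then ereal (\<phi> t) else \<infinity>)"

definition C_const :: "real \<Rightarrow> real \<Rightarrow> real" where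
  "C_const \<kappa>1 \<kappa>2 = (INF l\<in>{0..1}. (1 - l / (2 - \<kappa>1)) / (1 - l / (2 - \<kappa>1 * \<kappa>2)))"

end

theory Submission imports Defs begin

text \<open>
  Write \<open>k = \<kappa>1 * \<kappa>2\<close> and let \<open>y = l *\<^sub>R xbar + (1 - l) *\<^sub>R x\<close>. Strong quasar-convexity of
  \<open>h\<close> bounds \<open>h y\<close> by \<open>T - D\<close>, where \<open>T\<close> is the convex combination of \<open>h xbar\<close> and \<open>h x\<close> with
  weight \<open>\<kappa>1 * l\<close> on \<open>h xbar\<close>, and \<open>D \<ge> 0\<close> is the quadratic gain. Since \<open>T\<close> lies in the
  interval \<open>I\<close>, the growth condition on \<open>\<phi>\<close> turns this into \<open>\<phi> (h y) \<le> \<phi> T - m * D\<close>, and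
  quasar-convexity of \<open>\<phi>\<close>, used with the parameter \<open>\<kappa>1 * l\<close>, bounds \<open>\<phi> T\<close> by the combination of
  \<open>\<phi> (h xbar)\<close> and \<open>\<phi> (h x)\<close> with weight \<open>k * l\<close> on the former.

  The gain \<open>D\<close> carries the factor \<open>1 - l / (2 - \<kappa>1)\<close>, while the definition for the parameter
  \<open>k\<close> asks for the factor \<open>1 - l / (2 - k)\<close>. The constant \<open>C_const \<kappa>1 \<kappa>2\<close> is the largest one
  by which the second factor can be scaled without exceeding the first on \<open>[0, 1]\<close>. The quotient of
  the two factors decreases in \<open>l\<close> because \<open>k \<le> \<kappa>1\<close>, so its infimum is its value at \<open>l = 1\<close>,
  which is positive because \<open>\<kappa>1 < 1\<close>.
\<close>

text \<open>
  The next two lemmas translate between the extended-real definition and real inequalities;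
  the introduction rule covers functions that are finite everywhere.
\<close>

lemma strongly_quasar_convex_realI:
  fixes f :: "'a::euclidean_space \<Rightarrow> real"
  assumes "0 < \<kappa>" "\<kappa> \<le> 1" "0 \<le> \<gamma>"
    and "\<And>x. f xbar \<le> f x"
    and "\<And>x l. 0 \<le> l \<Longrightarrow> l \<le> 1 \<Longrightarrow>
      f (l *\<^sub>R xbar + (1 - l) *\<^sub>R x) \<le> \<kappa> * l * f xbar + (1 - \<kappa> * l) * f x
        - l * (1 - l / (2 - \<kappa>)) * (\<kappa> * \<gamma> / 2) * (norm (x - xbar))\<^sup>2"
  shows "strongly_quasar_convex \<kappa> \<gamma> (\<lambda>x. ereal (f x)) xbar"
  using assms
  by (auto simp: strongly_quasar_convex_def proper_def effective_domain_def is_arg_min_def not_less)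

lemma strongly_quasar_convex_realD:
  fixes h :: "'a::euclidean_space \<Rightarrow> ereal"
  assumes sqc: "strongly_quasar_convex \<kappa> \<gamma> h xbar"
    and fin: "h x = ereal a" "h xbar = ereal b" "h (l *\<^sub>R xbar + (1 - l) *\<^sub>R x) = ereal c"
    and l: "0 \<le> l" "l \<le> 1"
  shows "c \<le> \<kappa> * l * b + (1 - \<kappa> * l) * a
    - l * (1 - l / (2 - \<kappa>)) * (\<kappa> * \<gamma> / 2) * (norm (x - xbar))\<^sup>2"
proof -
  have "x \<in> effective_domain h"
    using fin by (simp add: effective_domain_def)
  then have "h (l *\<^sub>R xbar + (1 - l) *\<^sub>R x)
      \<le> ereal (\<kappa> * l) * h xbar + ereal (1 - \<kappa> * l) * h x
        - ereal (l * (1 - l / (2 - \<kappa>)) * (\<kappa> * \<gamma> / 2) * (norm (x - xbar))\<^sup>2)"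
    using sqc l by (auto simp: strongly_quasar_convex_def)
  then show ?thesis
    using fin by simp
qed

text \<open>
  With \<open>a = 1 / (2 - \<kappa>1)\<close> and \<open>b = 1 / (2 - \<kappa>1 * \<kappa>2)\<close>, this locates the infimum in
  \<open>C_const \<kappa>1 \<kappa>2\<close> at \<open>l = 1\<close>.
\<close>

lemma factor_ratio_least_at_1:
  fixes a b l :: real
  assumes "0 \<le> b" "b \<le> a" "b < 1" "0 \<le> l" "l \<le> 1"
  shows "(1 - a) / (1 - b) \<le> (1 - l * a) / (1 - l * b)"
proof -
  have "l * b \<le> b"
    using assms by (simp add: mult_left_le_one_le)
  then have "l * b < 1"
    using assms by simp
  moreover have "(1 - l * a) * (1 - b) - (1 - a) * (1 - l * b) = (1 - l) * (a - b)"
    by (simp add: algebra_simps)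
  moreover have "0 \<le> (1 - l) * (a - b)"
    using assms by simp
  ultimately show ?thesis
    using assms by (simp add: divide_le_eq le_divide_eq field_simps)
qed

lemma
  assumes k: "0 < \<kappa>1" "\<kappa>1 < 1" "0 < \<kappa>2" "\<kappa>2 \<le> 1"
  shows C_const_eq:
      "C_const \<kappa>1 \<kappa>2 = (1 - \<kappa>1) * (2 - \<kappa>1 * \<kappa>2) / ((2 - \<kappa>1) * (1 - \<kappa>1 * \<kappa>2))" (is ?eq)
    and C_const_pos: "C_const \<kappa>1 \<kappa>2 > 0" (is ?pos)
    and C_const_mult_le: "\<And>l. 0 \<le> l \<Longrightarrow> l \<le> 1 \<Longrightarrow>
      C_const \<kappa>1 \<kappa>2 * (1 - l / (2 - \<kappa>1 * \<kappa>2)) \<le> 1 - l / (2 - \<kappa>1)"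
proof -
  define k where "k = \<kappa>1 * \<kappa>2"
  define r where "r = (\<lambda>l. (1 - l / (2 - \<kappa>1)) / (1 - l / (2 - k)))"
  have k1: "k \<le> \<kappa>1" "0 < k" "k < 1"
    using k by (auto simp: k_def mult_left_le intro: le_less_trans[of _ \<kappa>1])
  have least: "r 1 \<le> r l" if "0 \<le> l" "l \<le> 1" for l
    using factor_ratio_least_at_1[of "1 / (2 - k)" "1 / (2 - \<kappa>1)" l] that k k1
    by (simp add: r_def frac_le)
  have C: "C_const \<kappa>1 \<kappa>2 = r 1"
    unfolding C_const_def k_def[symmetric] r_def[symmetric]
    by (rule cInf_eq_minimum) (auto simp: least)
  also have r1: "r 1 = (1 - \<kappa>1) * (2 - k) / ((2 - \<kappa>1) * (1 - k))"
    using k k1 by (simp add: r_def diff_divide_eq_iff)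
  finally show ?eq
    by (simp add: k_def)
  show ?pos
    using k k1 by (simp add: C r1)
  fix l :: real
  assume l: "0 \<le> l" "l \<le> 1"
  have "l / (2 - k) < 1"
    using l k1 by simp
  then show "C_const \<kappa>1 \<kappa>2 * (1 - l / (2 - \<kappa>1 * \<kappa>2)) \<le> 1 - l / (2 - \<kappa>1)"
    using least[OF l] by (simp add: C r_def pos_le_divide_eq flip: k_def)
qed

theorem proposition25:
  fixes h :: "real ^ 'n \<Rightarrow> ereal" and xbar :: "real ^ 'n"
    and \<kappa>1 \<kappa>2 \<gamma> m :: real and I :: "real set" and \<phi> :: "real \<Rightarrow> real"
  assumes "proper h"
    and "is_arg_min h (\<lambda>_. True) xbar"
    and "0 < \<kappa>1" and "\<kappa>1 < 1" and "0 \<le> \<gamma>"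
    and "strongly_quasar_convex \<kappa>1 \<gamma> h xbar"
    and "is_interval I" and "range h \<subseteq> ereal ` I"
    and "0 < \<kappa>2" and "\<kappa>2 \<le> 1"
    and "quasar_convex \<kappa>2 (extend_infty I \<phi>) (real_of_ereal (h xbar))"
    and "0 \<le> m"
    and "\<forall>s\<in>I. \<forall>t\<in>I. s \<le> t \<longrightarrow> \<phi> t - \<phi> s \<ge> m * (t - s)"
  shows "strongly_quasar_convex (\<kappa>1 * \<kappa>2) (C_const \<kappa>1 \<kappa>2 * m * \<gamma> / \<kappa>2)
           (\<lambda>x. ereal (\<phi> (real_of_ereal (h x)))) xbar
    \<and> C_const \<kappa>1 \<kappa>2 = (1 - \<kappa>1) * (2 - \<kappa>1 * \<kappa>2) / ((2 - \<kappa>1) * (1 - \<kappa>1 * \<kappa>2))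
    \<and> C_const \<kappa>1 \<kappa>2 > 0"
proof -
  define H where "H = (\<lambda>x. real_of_ereal (h x))"
  define C where "C = C_const \<kappa>1 \<kappa>2"
  note k = assms(3,4,9,10)
  have HI: "H x \<in> I" and hH: "h x = ereal (H x)" for x
  proof -
    obtain t where "t \<in> I" "h x = ereal t"
      using assms(8) by blast
    then show "H x \<in> I" "h x = ereal (H x)"
      by (simp_all add: H_def)
  qed
  have phi: "strongly_quasar_convex \<kappa>2 0 (extend_infty I \<phi>) (H xbar)"
    using assms(11) by (simp add: quasar_convex_def H_def)
  have ext: "extend_infty I \<phi> t = ereal (\<phi> t)" if "t \<in> I" for t
    using that by (simp add: extend_infty_def)
  have Cpos: "0 < C"
    unfolding C_def by (rule C_const_pos[OF k])
  have "strongly_quasar_convex (\<kappa>1 * \<kappa>2) (C * m * \<gamma> / \<kappa>2) (\<lambda>x. ereal (\<phi> (H x))) xbar"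
  proof (rule strongly_quasar_convex_realI)
    show "0 < \<kappa>1 * \<kappa>2" "\<kappa>1 * \<kappa>2 \<le> 1" "0 \<le> C * m * \<gamma> / \<kappa>2"
      using k assms(5,12) Cpos by (auto simp: mult_le_one)
  next
    fix x
    have "is_arg_min (extend_infty I \<phi>) (\<lambda>_. True) (H xbar)"
      using phi by (simp add: strongly_quasar_convex_def)
    then have "extend_infty I \<phi> (H xbar) \<le> extend_infty I \<phi> (H x)"
      by (auto simp: is_arg_min_def not_less)
    then show "\<phi> (H xbar) \<le> \<phi> (H x)"
      by (simp add: ext HI)
  next
    fix x and l :: real
    assume l: "0 \<le> l" "l \<le> 1"
    define y where "y = l *\<^sub>R xbar + (1 - l) *\<^sub>R x"
    define T where "T = (\<kappa>1 * l) *\<^sub>R H xbar + (1 - \<kappa>1 * l) *\<^sub>R H x"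
    define N where "N = (norm (x - xbar))\<^sup>2"
    define D where "D = l * (1 - l / (2 - \<kappa>1)) * (\<kappa>1 * \<gamma> / 2) * N"
    have kl: "0 \<le> \<kappa>1 * l" "\<kappa>1 * l \<le> 1"
      using k l by (auto simp: mult_le_one)
    \<comment> \<open>\<open>T - D\<close> may lie outside \<open>I\<close>, so the growth condition is applied to \<open>H y\<close> and \<open>T\<close>.\<close>
    have TI: "T \<in> I"
      unfolding T_def using is_interval_convex[OF assms(7)] HI kl by (intro convexD) auto
    have Hy: "H y \<le> T - D"
      using strongly_quasar_convex_realD[OF assms(6) hH hH hH l]
      by (simp add: y_def T_def D_def N_def)
    have "0 \<le> D"
      unfolding D_def N_def using k l assms(5) by (intro mult_nonneg_nonneg) auto
    with Hy have "m * (T - H y) \<le> \<phi> T - \<phi> (H y)"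
      using assms(13) HI TI by auto
    moreover have "m * D \<le> m * (T - H y)"
      using Hy assms(12) by (intro mult_left_mono) auto
    moreover have "\<phi> T \<le> \<kappa>1 * \<kappa>2 * l * \<phi> (H xbar) + (1 - \<kappa>1 * \<kappa>2 * l) * \<phi> (H x)"
      using strongly_quasar_convex_realD[OF phi ext[OF HI] ext[OF HI] ext[OF TI[unfolded T_def]] kl]
      by (simp add: T_def mult_ac)
    moreover have
      "l * (1 - l / (2 - \<kappa>1 * \<kappa>2)) * (\<kappa>1 * \<kappa>2 * (C * m * \<gamma> / \<kappa>2) / 2) * N \<le> m * D"
    proof -
      have "(C * (1 - l / (2 - \<kappa>1 * \<kappa>2))) * (m * (l * (\<kappa>1 * \<gamma> / 2) * N))
          \<le> (1 - l / (2 - \<kappa>1)) * (m * (l * (\<kappa>1 * \<gamma> / 2) * N))"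
        unfolding N_def C_def using k l assms(5,12)
        by (intro mult_right_mono C_const_mult_le mult_nonneg_nonneg) auto
      moreover have "\<kappa>1 * \<kappa>2 * (C * m * \<gamma> / \<kappa>2) / 2 = C * m * (\<kappa>1 * \<gamma> / 2)"
        using k by simp
      ultimately show ?thesis
        unfolding D_def by (simp only: mult_ac)
    qed
    ultimately show "\<phi> (H (l *\<^sub>R xbar + (1 - l) *\<^sub>R x))
        \<le> \<kappa>1 * \<kappa>2 * l * \<phi> (H xbar) + (1 - \<kappa>1 * \<kappa>2 * l) * \<phi> (H x)
          - l * (1 - l / (2 - \<kappa>1 * \<kappa>2)) * (\<kappa>1 * \<kappa>2 * (C * m * \<gamma> / \<kappa>2) / 2)
            * (norm (x - xbar))\<^sup>2"
      unfolding y_def[symmetric] N_def[symmetric] by linarith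
  qed
  then show ?thesis
    using C_const_eq[OF k] C_const_pos[OF k] by (simp add: H_def C_def)
qed

end
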